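(* Let $0<\delta\le 1$. Consider a sequence of reward functions $(f_t)_t$ on a compact convex set $\mathcal{D}\subset\mathbb{R}^d$ and observations $y_t=f_t(x_t)+\epsilon_t$ with $\epsilon_t\sim\mathcal{N}(0,\sigma^2)$ i.i.d. Let $k$ be a squared exponential kernel and suppose: (1) $k$ is continuous and bounded with $k(x,x)\le M_k^2$ for all $x\in\mathcal{D}$, and for all $t$ the function $f_t$ belongs to the RKHS $\mathcal{H}_k(\mathcal{D})$ with $\|f_t\|_k\le B$; (2) $\sup_{x\in\mathcal{D}}|f_{t+1}(x)-f_t(x)|\le 1$ for all $t$. Let SparQ-GP-UCB (described in the context) be run for $T$ iterations with $$\beta_t=\sqrt{2\log\left(\frac{2\,|\Sigma^{\mathrm{s}}_t+K^{\mathrm{s}}_{tt}|^{1/2}}{\delta\,|\Sigma^{\mathrm{s}}_t|^{1/2}}\right)}+\|f_t\|_k$$ and $\mathcal{O}(\log^d(t))$ expert queries at each time step $t$. Then the computational complexity of SparQ-GP-UCB is upper bounded by $$\mathcal{O}\left(T^2\log(T)\log^{3d}\left(\frac{T}{\log(T)}\right)\right)=\tilde{\mathcal{O}}(T^2).$$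
   Context: Notation: $|A|$ denotes the determinant of a matrix $A$; $\tilde{\mathcal{O}}$ hides poly-logarithmic factors in $T$; $\|\cdot\|_k$ is the norm of the RKHS $\mathcal{H}_k(\mathcal{D})$. Uncertainty injection (standing modelling assumption). At time $t$, a past observation $y_i$ ($i\le t$) is treated as a noisy observation of the current function $f_t$: $y_i=f_t(x_i)+\epsilon_{i,t}$, where the $\epsilon_{i,t}\sim\mathcal{N}(0,\sigma^2((t-i)^2+1))$ are independent. Expert. At time $t$ the expert can be queried at any previously chosen point $x$ and returns an evaluation of $f_t(x)$ corrupted by independent zero-mean Gaussian noise of fixed variance $\bar\sigma^2$. $M$-DPP. For a positive semidefinite kernel matrix $K$, an $M$-determinantal point process is the probability distribution on the subsets $Z$ of size $M$ of the columns (equivalently, of the input points) with $\Pr(Z)=\det(K_{Z,Z})/\sum_{|Z'|=M}\det(K_{Z',Z'})$. An $\varepsilon$-approximate $M$-DPP is a distribution on such subsets within total variation distance $\varepsilon$ of it. MCMC sampler. An approximate $M$-DPP sample from $N$ inputs $X$ is produced as follows. Start from a set $Z_0$ of $M$ inputs built greedily: repeatedly add the $x\in X$ maximizing the Schur complement $k(x,x)-k(x,Z)K_{ZZ}^{-1}k(x,Z)^\top$ relative to the current set $Z$. At each MCMC step, draw $i$ uniformly from the current set $Z_n$ and $j$ uniformly from $X\setminus Z_n$, and replace $Z_n$ by $Z'=(Z_n\setminus\{i\})\cup\{j\}$ with probability $\frac12\min\{1,\det(K_{Z'})/\det(K_{Z_n})\}$. The cost of obtaining an $\varepsilon$-approximate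 $M$-DPP sample from $N$ inputs with this sampler is (known result of Burt et al.) $\mathcal{O}(NM^3(\log\log N+\log M+\log 1/\varepsilon^2))$. Gaussian process regression with $M$ inputs costs $\mathcal{O}(M^3)$. Algorithm SparQ-GP-UCB. For $t=1,2,\dots$: 1. Observe $y_t=f_t(x_t)+\epsilon_t$. 2. Discard all observations $y_i$, $i\le t$, whose noise variance $\sigma^2((t-i)^2+1)$ exceeds $\sigma^2\log(t)$. 3. Perform sparse inference on $X_t=[x_1,\dots,x_t]$: draw a set $X^{\mathrm{E}}\subset X_t$ of $Q_t$ points from an $\varepsilon_t$-approximate $Q_t$-DPP for the kernel matrix of $X_t$, using the MCMC sampler. Here $Q_t=\mathcal{O}(\log^d(t))$ and $\varepsilon_t$ is of order $1/t$, chosen for a fixed accuracy of the sparse approximation. 4. Query the expert for updated noisy observations of $f_t$ at the points of $X^{\mathrm{E}}$. 5. Let $(X^{\mathrm{s}}_t,Y^{\mathrm{s}}_t)$ be the expert-delivered observations together with the non-discarded ones. Let $\Sigma^{\mathrm{s}}_t$ be the diagonal matrix of their noise variances, let $K^{\mathrm{s}}_t$ (also written $K^{\mathrm{s}}_{tt}$) be the kernel matrix of $X^{\mathrm{s}}_t$, and let $k^{\mathrm{s}}_t(x)$ be the vector of values $k(x',x)$, $x'\in X^{\mathrm{s}}_t$. Compute $$\mu^{\mathrm{s}}_t(x)=k^{\mathrm{s}}_t(x)^\top(K^{\mathrm{s}}_t+\Sigma^{\mathrm{s}}_t)^{-1}Y^{\mathrm{s}}_t,\qquad (\sigma^{\mathrm{s}}_t)^2(x)=k(x,x)-k^{\mathrm{s}}_t(x)^\top(K^{\mathrm{s}}_t+\Sigma^{\mathrm{s}}_t)^{-1}k^{\mathrm{s}}_t(x).$$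 6. Choose $x_{t+1}\in\arg\max_{x\in\mathcal{D}}\ \mu^{\mathrm{s}}_t(x)+\beta_{t+1}\sigma^{\mathrm{s}}_t(x)$. Cost convention: the computational complexity counts the sparse-inference sampling and the Gaussian process regression updates over the $T$ iterations. The cost of the expert's answers and of solving the $\arg\max$ in step 6 is not counted. *)

theory Defs
  imports
    "HOL-Probability.Probability"
    "HOL-Library.Landau_Symbols"
    "Jordan_Normal_Form.Determinant"
    "Jordan_Normal_Form.Gauss_Jordan_Elimination"
    "Jordan_Normal_Form.DL_Submatrix"
begin

section \<open>Kernels and reproducing kernel Hilbert spaces\<close>

definition squared_exponential_kernel :: "('a::real_normed_vector \<Rightarrow> 'a \<Rightarrow> real) \<Rightarrow> bool" where
  "squared_exponential_kernel k \<longleftrightarrow>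
     (\<exists>v>0. \<exists>l>0. \<forall>x y. k x y = v * exp (- (norm (x - y))\<^sup>2 / (2 * l\<^sup>2)))"

text \<open>
  Functions on \<open>D\<close> are represented by total functions that vanish outside \<open>D\<close>;
  \<open>H\<close> is the carrier of the Hilbert space and \<open>ip\<close> its inner product, which is
  only constrained on \<open>H\<close>. The last two assumptions determine \<open>H\<close> and \<open>ip\<close> on \<open>H\<close>
  uniquely from \<open>D\<close> and \<open>k\<close>.
\<close>

locale rkhs =
  fixes D :: "'a set" and k :: "'a \<Rightarrow> 'a \<Rightarrow> real"
    and H :: "('a \<Rightarrow> real) set" and ip :: "('a \<Rightarrow> real) \<Rightarrow> ('a \<Rightarrow> real) \<Rightarrow> real"
  assumes supported: "g \<in> H \<Longrightarrow> x \<notin> D \<Longrightarrow> g x = 0"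
    and zero: "(\<lambda>_. 0) \<in> H"
    and add: "g \<in> H \<Longrightarrow> h \<in> H \<Longrightarrow> (\<lambda>x. g x + h x) \<in> H"
    and scale: "g \<in> H \<Longrightarrow> (\<lambda>x. c * g x) \<in> H"
    and ip_commute: "g \<in> H \<Longrightarrow> h \<in> H \<Longrightarrow> ip g h = ip h g"
    and ip_add: "g \<in> H \<Longrightarrow> g' \<in> H \<Longrightarrow> h \<in> H \<Longrightarrow> ip (\<lambda>x. g x + g' x) h = ip g h + ip g' h"
    and ip_scale: "g \<in> H \<Longrightarrow> h \<in> H \<Longrightarrow> ip (\<lambda>x. c * g x) h = c * ip g h"
    and ip_pos: "g \<in> H \<Longrightarrow> g \<noteq> (\<lambda>_. 0) \<Longrightarrow> ip g g > 0"
    and complete: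
      "(\<And>n. u n \<in> H) \<Longrightarrow>
       (\<forall>e>0. \<exists>n0. \<forall>m\<ge>n0. \<forall>n\<ge>n0. ip (\<lambda>x. u m x - u n x) (\<lambda>x. u m x - u n x) < e) \<Longrightarrow>
       \<exists>g\<in>H. (\<lambda>n. ip (\<lambda>x. u n x - g x) (\<lambda>x. u n x - g x)) \<longlonglongrightarrow> 0"
    and kernel_section: "x \<in> D \<Longrightarrow> (\<lambda>y. if y \<in> D then k y x else 0) \<in> H"
    and reproducing: "x \<in> D \<Longrightarrow> g \<in> H \<Longrightarrow> ip g (\<lambda>y. if y \<in> D then k y x else 0) = g x"

definition rkhs_norm :: "(('a \<Rightarrow> real) \<Rightarrow> ('a \<Rightarrow> real) \<Rightarrow> real) \<Rightarrow> ('a \<Rightarrow> real) \<Rightarrow> real" where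
  "rkhs_norm ip g = sqrt (ip g g)"

section \<open>Gaussian process regression\<close>

definition kernel_mat :: "('a \<Rightarrow> 'a \<Rightarrow> real) \<Rightarrow> 'a list \<Rightarrow> real Matrix.mat" where
  "kernel_mat k X = Matrix.mat (length X) (length X) (\<lambda>(i, j). k (X ! i) (X ! j))"

definition mat_inv :: "real Matrix.mat \<Rightarrow> real Matrix.mat" where
  "mat_inv A = the (mat_inverse A)"

text \<open>A data set is a list of triples (input, observation, noise variance).\<close>

type_synonym 'a data = "('a \<times> real \<times> real) list"

definition inputs :: "'a data \<Rightarrow> 'a list" where
  "inputs ds = map fst ds"

definition obs_vec :: "'a data \<Rightarrow> real Matrix.vec" where
  "obs_vec ds = Matrix.vec (length ds) (\<lambda>i. fst (snd (ds ! i)))"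

definition noise_mat :: "'a data \<Rightarrow> real Matrix.mat" where
  "noise_mat ds = mat_diag (length ds) (\<lambda>i. snd (snd (ds ! i)))"

definition data_mat :: "('a \<Rightarrow> 'a \<Rightarrow> real) \<Rightarrow> 'a data \<Rightarrow> real Matrix.mat" where
  "data_mat k ds = kernel_mat k (inputs ds)"

definition kernel_vec :: "('a \<Rightarrow> 'a \<Rightarrow> real) \<Rightarrow> 'a data \<Rightarrow> 'a \<Rightarrow> real Matrix.vec" where
  "kernel_vec k ds x = Matrix.vec (length ds) (\<lambda>i. k (inputs ds ! i) x)"

definition post_mean :: "('a \<Rightarrow> 'a \<Rightarrow> real) \<Rightarrow> 'a data \<Rightarrow> 'a \<Rightarrow> real" where
  "post_mean k ds x =
     scalar_prod (kernel_vec k ds x)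
       (mult_mat_vec (mat_inv (data_mat k ds + noise_mat ds)) (obs_vec ds))"

definition post_var :: "('a \<Rightarrow> 'a \<Rightarrow> real) \<Rightarrow> 'a data \<Rightarrow> 'a \<Rightarrow> real" where
  "post_var k ds x =
     k x x - scalar_prod (kernel_vec k ds x)
       (mult_mat_vec (mat_inv (data_mat k ds + noise_mat ds)) (kernel_vec k ds x))"

text \<open>The exploration weight; \<open>b\<close> stands for the RKHS norm of the current reward function.\<close>

definition ucb_beta :: "('a \<Rightarrow> 'a \<Rightarrow> real) \<Rightarrow> real \<Rightarrow> 'a data \<Rightarrow> real \<Rightarrow> real" where
  "ucb_beta k \<delta> ds b =
     sqrt (2 * ln (2 * sqrt (Determinant.det (noise_mat ds + data_mat k ds)) /
                   (\<delta> * sqrt (Determinant.det (noise_mat ds))))) + b"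

section \<open>Determinantal point processes of fixed size\<close>

text \<open>
  Inputs are addressed by their positions \<open>0, \<dots>, N - 1\<close>, i.e. by the columns of the
  kernel matrix, so that repeated inputs cause no ambiguity.
\<close>

definition psd_mat :: "nat \<Rightarrow> real Matrix.mat \<Rightarrow> bool" where
  "psd_mat N K \<longleftrightarrow> K \<in> carrier_mat N N \<and> transpose_mat K = K \<and>
     (\<forall>v\<in>carrier_vec N. scalar_prod v (mult_mat_vec K v) \<ge> 0)"

definition msubsets :: "real Matrix.mat \<Rightarrow> nat \<Rightarrow> nat set set" where
  "msubsets K M = {Z. Z \<subseteq> {..<dim_row K} \<and> card Z = M}"

definition pminor :: "real Matrix.mat \<Rightarrow> nat set \<Rightarrow> real" where
  "pminor K Z = Determinant.det (submatrix K Z Z)"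

definition dpp_normalizer :: "real Matrix.mat \<Rightarrow> nat \<Rightarrow> real" where
  "dpp_normalizer K M = (\<Sum>Z\<in>msubsets K M. pminor K Z)"

definition dpp :: "real Matrix.mat \<Rightarrow> nat \<Rightarrow> nat set pmf" where
  "dpp K M =
     embed_pmf (\<lambda>Z. if Z \<in> msubsets K M then pminor K Z / dpp_normalizer K M else 0)"

lemma finite_msubsets: "finite (msubsets K M)"
  by (rule finite_subset[of _ "Pow {..<dim_row K}"]) (auto simp: msubsets_def)

lemma pmf_dpp:
  assumes "\<And>Z. Z \<in> msubsets K M \<Longrightarrow> pminor K Z \<ge> 0" and "dpp_normalizer K M \<noteq> 0"
  shows "pmf (dpp K M) Z =
    (if Z \<in> msubsets K M then pminor K Z / dpp_normalizer K M else 0)"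
proof -
  let ?w = "\<lambda>Z. if Z \<in> msubsets K M then pminor K Z / dpp_normalizer K M else 0"
  have pos: "dpp_normalizer K M > 0"
    using assms sum_nonneg[of "msubsets K M" "pminor K"] by (simp add: dpp_normalizer_def)
  have nonneg: "?w Z \<ge> 0" for Z
    using assms(1) pos by auto
  have nonneg': "pminor K Z / dpp_normalizer K M \<ge> 0" if "Z \<in> msubsets K M" for Z
    using assms(1)[OF that] pos by simp
  have "(\<integral>\<^sup>+Z. ennreal (?w Z) \<partial>count_space UNIV) = (\<Sum>Z\<in>msubsets K M. ennreal (?w Z))"
    by (intro nn_integral_count_space' finite_msubsets) auto
  also have "\<dots> = ennreal (\<Sum>Z\<in>msubsets K M. ?w Z)"
    using nonneg' by (intro sum_ennreal) auto
  also have "(\<Sum>Z\<in>msubsets K M. ?w Z) = 1"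
    using pos by (simp add: dpp_normalizer_def flip: sum_divide_distrib)
  finally show ?thesis
    unfolding dpp_def using nonneg' by (subst pmf_embed_pmf) auto
qed

definition tv_dist :: "'b pmf \<Rightarrow> 'b pmf \<Rightarrow> real" where
  "tv_dist p q = (SUP A. \<bar>measure_pmf.prob p A - measure_pmf.prob q A\<bar>)"

text \<open>
  If all principal minors of size \<open>M\<close> vanish (fewer than \<open>M\<close> distinct inputs), there is no
  \<open>M\<close>-DPP; in this case nothing is required beyond producing \<open>M\<close> positions.
\<close>

definition approx_dpp :: "real Matrix.mat \<Rightarrow> nat \<Rightarrow> real \<Rightarrow> nat set pmf \<Rightarrow> bool" where
  "approx_dpp K M \<epsilon> p \<longleftrightarrow> set_pmf p \<subseteq> msubsets K M \<and>
     (dpp_normalizer K M \<noteq> 0 \<longrightarrow> tv_dist p (dpp K M) \<le> \<epsilon>)"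

section \<open>The MCMC sampler\<close>

definition schur :: "real Matrix.mat \<Rightarrow> nat set \<Rightarrow> nat \<Rightarrow> real" where
  "schur K Z i =
     (let kv = Matrix.vec (card Z) (\<lambda>j. K $$ (i, pick Z j))
      in K $$ (i, i) - scalar_prod kv (mult_mat_vec (mat_inv (submatrix K Z Z)) kv))"

text \<open>
  The maximum is taken over the positions not yet chosen (the Schur complement vanishes on
  chosen ones); ties are broken arbitrarily.
\<close>

primrec greedy_init :: "real Matrix.mat \<Rightarrow> nat \<Rightarrow> nat set" where
  "greedy_init K 0 = {}"
| "greedy_init K (Suc m) =
     insert (arg_max_on (schur K (greedy_init K m)) ({..<dim_row K} - greedy_init K m))
       (greedy_init K m)"

text \<open>The chain stays put when there is nothing to exchange.\<close>

definition mcmc_step :: "real Matrix.mat \<Rightarrow> nat set \<Rightarrow> nat set pmf" where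
  "mcmc_step K Z =
     (if Z = {} \<or> {..<dim_row K} - Z = {} then return_pmf Z
      else bind_pmf (pmf_of_set Z) (\<lambda>i.
           bind_pmf (pmf_of_set ({..<dim_row K} - Z)) (\<lambda>j.
             let Z' = insert j (Z - {i})
             in map_pmf (\<lambda>b. if b then Z' else Z)
                  (bernoulli_pmf (1 / 2 * min 1 (pminor K Z' / pminor K Z))))))"

primrec mcmc_law :: "real Matrix.mat \<Rightarrow> nat \<Rightarrow> nat \<Rightarrow> nat set pmf" where
  "mcmc_law K M 0 = return_pmf (greedy_init K M)"
| "mcmc_law K M (Suc n) = bind_pmf (mcmc_law K M n) (mcmc_step K)"

text \<open>
  \<open>steps N M \<epsilon>\<close> is the number of MCMC steps performed to obtain an \<open>\<epsilon>\<close>-approximate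
  \<open>M\<close>-DPP sample from \<open>N\<close> inputs. It may not depend on the kernel matrix.
\<close>

definition valid_schedule :: "(nat \<Rightarrow> nat \<Rightarrow> real \<Rightarrow> nat) \<Rightarrow> bool" where
  "valid_schedule steps \<longleftrightarrow>
     (\<forall>N M \<epsilon> K. psd_mat N K \<and> M \<le> N \<and> \<epsilon> > 0 \<longrightarrow>
        approx_dpp K M \<epsilon> (mcmc_law K M (steps N M \<epsilon>)))"

text \<open>
  \<open>cinit N M\<close> is the cost of the greedy initialization and \<open>cstep N M\<close> the cost of one MCMC
  step. Drawing the empty set costs nothing.
\<close>

definition sampling_cost ::
  "(nat \<Rightarrow> nat \<Rightarrow> real) \<Rightarrow> (nat \<Rightarrow> nat \<Rightarrow> real) \<Rightarrow> (nat \<Rightarrow> nat \<Rightarrow> real \<Rightarrow> nat) \<Rightarrow>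
   nat \<Rightarrow> nat \<Rightarrow> real \<Rightarrow> real" where
  "sampling_cost cinit cstep steps N M \<epsilon> =
     (if M = 0 then 0 else cinit N M + real (steps N M \<epsilon>) * cstep N M)"

text \<open>
  The mixing result of Burt et al.: the sampler is correct at a cost of
  \<open>O(N M\<^sup>3 (log log N + log M + log (1 / \<epsilon>\<^sup>2)))\<close>. The bound is stated from \<open>N = 3\<close> on because
  \<open>log log N\<close> is not positive before.
\<close>

definition sampler_guarantee ::
  "(nat \<Rightarrow> nat \<Rightarrow> real) \<Rightarrow> (nat \<Rightarrow> nat \<Rightarrow> real) \<Rightarrow> (nat \<Rightarrow> nat \<Rightarrow> real \<Rightarrow> nat) \<Rightarrow> bool" where
  "sampler_guarantee cinit cstep steps \<longleftrightarrow>
     valid_schedule steps \<and>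
     (\<exists>C. \<forall>N\<ge>3. \<forall>M\<in>{1..N}. \<forall>\<epsilon>\<in>{0<..1}.
        sampling_cost cinit cstep steps N M \<epsilon> \<le>
          C * (real N * real M ^ 3 * (ln (ln (real N)) + ln (real M) + ln (1 / \<epsilon>\<^sup>2))))"

section \<open>The algorithm\<close>

text \<open>
  One trajectory up to time \<open>t\<close>: \<open>xs i\<close> and \<open>ys i\<close> are the inputs and observations at times
  \<open>i \<ge> 1\<close>; \<open>Z\<close> is the set of positions in the list \<open>X\<^sub>t = [x\<^sub>1, \<dots>, x\<^sub>t]\<close> at which the expert is
  queried, so position \<open>j\<close> stands for \<open>x\<^sub>j\<^sub>+\<^sub>1\<close>; \<open>u j\<close> is the noise of the expert's answer at
  position \<open>j\<close>. Since the reward function drifts, the observation made at time \<open>i\<close> is regarded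
  at time \<open>t\<close> as an observation of \<open>f t\<close> with noise variance \<open>\<sigma>\<^sup>2 ((t - i)\<^sup>2 + 1)\<close>.
\<close>

definition points :: "(nat \<Rightarrow> 'a) \<Rightarrow> nat \<Rightarrow> 'a list" where
  "points xs t = map xs [1..<Suc t]"

definition injected_var :: "real \<Rightarrow> nat \<Rightarrow> nat \<Rightarrow> real" where
  "injected_var \<sigma> t i = \<sigma>\<^sup>2 * ((real t - real i)\<^sup>2 + 1)"

definition expert_data ::
  "(nat \<Rightarrow> 'a \<Rightarrow> real) \<Rightarrow> real \<Rightarrow> (nat \<Rightarrow> 'a) \<Rightarrow> (nat \<Rightarrow> real) \<Rightarrow> nat set \<Rightarrow> nat \<Rightarrow> 'a data" where
  "expert_data f \<sigma>e xs u Z t =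
     map (\<lambda>j. (points xs t ! j, f t (points xs t ! j) + u j, \<sigma>e\<^sup>2)) (sorted_list_of_set Z)"

definition kept_data ::
  "real \<Rightarrow> (nat \<Rightarrow> 'a) \<Rightarrow> (nat \<Rightarrow> real) \<Rightarrow> nat \<Rightarrow> 'a data" where
  "kept_data \<sigma> xs ys t =
     map (\<lambda>i. (xs i, ys i, injected_var \<sigma> t i))
       (filter (\<lambda>i. \<not> injected_var \<sigma> t i > \<sigma>\<^sup>2 * ln (real t)) [1..<Suc t])"

definition sparse_data ::
  "(nat \<Rightarrow> 'a \<Rightarrow> real) \<Rightarrow> real \<Rightarrow> real \<Rightarrow> (nat \<Rightarrow> 'a) \<Rightarrow> (nat \<Rightarrow> real) \<Rightarrow> (nat \<Rightarrow> real) \<Rightarrow>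
   nat set \<Rightarrow> nat \<Rightarrow> 'a data" where
  "sparse_data f \<sigma> \<sigma>e xs ys u Z t = expert_data f \<sigma>e xs u Z t @ kept_data \<sigma> xs ys t"

definition run_data ::
  "(nat \<Rightarrow> 'a \<Rightarrow> real) \<Rightarrow> real \<Rightarrow> real \<Rightarrow> (nat \<Rightarrow> 'w \<Rightarrow> 'a) \<Rightarrow> (nat \<Rightarrow> 'w \<Rightarrow> real) \<Rightarrow>
   (nat \<Rightarrow> nat \<Rightarrow> 'w \<Rightarrow> real) \<Rightarrow> (nat \<Rightarrow> 'w \<Rightarrow> nat set) \<Rightarrow> 'w \<Rightarrow> nat \<Rightarrow> 'a data" where
  "run_data f \<sigma> \<sigma>e x y eta S \<omega> t =
     sparse_data f \<sigma> \<sigma>e (\<lambda>i. x i \<omega>) (\<lambda>i. y i \<omega>) (\<lambda>j. eta t j \<omega>) (S t \<omega>) t"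

text \<open>
  The information available when the expert positions of time \<open>t\<close> are drawn: inputs and
  observation noise up to time \<open>t\<close>, expert noise and expert positions before time \<open>t\<close>.
\<close>

definition history ::
  "'w measure \<Rightarrow> (nat \<Rightarrow> 'w \<Rightarrow> 'a::topological_space) \<Rightarrow> (nat \<Rightarrow> 'w \<Rightarrow> real) \<Rightarrow>
   (nat \<Rightarrow> nat \<Rightarrow> 'w \<Rightarrow> real) \<Rightarrow> (nat \<Rightarrow> 'w \<Rightarrow> nat set) \<Rightarrow> nat \<Rightarrow> 'w measure" where
  "history P x eps eta S t = sigma (space P)
     ({x i -` A \<inter> space P | i A. i \<in> {1..t} \<and> A \<in> sets borel} \<union>
      {eps i -` A \<inter> space P | i A. i \<in> {1..t} \<and> A \<in> sets borel} \<union>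
      {eta i j -` A \<inter> space P | i j A. i \<in> {1..<t} \<and> A \<in> sets borel} \<union>
      {S i -` A \<inter> space P | i A. i \<in> {1..<t}})"

text \<open>
  A run of SparQ-GP-UCB on the probability space \<open>P\<close>. Parameters: expert budget \<open>Q t\<close>, accuracy
  \<open>acc t\<close> of the approximate DPP, schedule \<open>steps\<close> of the sampler.

  Assumption \<open>sampling\<close> says that, given the history, the expert positions have the law of the
  MCMC sampler applied to the kernel matrix of \<open>X\<^sub>t\<close>.

  The parameter \<open>h\<close> fixes from which iteration the matrices in the weight \<open>\<beta>\<^bsub>t+1\<^esub>\<close> are taken
  when \<open>x\<^bsub>t+1\<^esub>\<close> is chosen. With \<open>h = 1\<close> these are the matrices with index \<open>t + 1\<close>, which
  themselves involve \<open>x\<^bsub>t+1\<^esub>\<close>, so that the choice becomes an implicit condition; with \<open>h = 0\<close> they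
  are the matrices with index \<open>t\<close>, the latest ones that have been computed at that point.
\<close>

locale sparq_gp_ucb = prob_space P
  for P :: "'w measure" +
  fixes D :: "'a::euclidean_space set" and k :: "'a \<Rightarrow> 'a \<Rightarrow> real"
    and ip :: "('a \<Rightarrow> real) \<Rightarrow> ('a \<Rightarrow> real) \<Rightarrow> real"
    and f :: "nat \<Rightarrow> 'a \<Rightarrow> real"
    and \<delta> \<sigma> \<sigma>e :: real
    and Q :: "nat \<Rightarrow> nat" and acc :: "nat \<Rightarrow> real"
    and steps :: "nat \<Rightarrow> nat \<Rightarrow> real \<Rightarrow> nat"
    and h :: nat
    and x :: "nat \<Rightarrow> 'w \<Rightarrow> 'a" and y eps :: "nat \<Rightarrow> 'w \<Rightarrow> real"
    and eta :: "nat \<Rightarrow> nat \<Rightarrow> 'w \<Rightarrow> real" and S :: "nat \<Rightarrow> 'w \<Rightarrow> nat set"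
  assumes x_measurable: "t \<ge> 1 \<Longrightarrow> x t \<in> borel_measurable P"
    and S_measurable: "t \<ge> 1 \<Longrightarrow> S t \<in> measurable P (count_space UNIV)"
    and obs_noise: "t \<ge> 1 \<Longrightarrow> distributed P lborel (eps t) (normal_density 0 \<sigma>)"
    and expert_noise: "t \<ge> 1 \<Longrightarrow> distributed P lborel (eta t j) (normal_density 0 \<sigma>e)"
    and noise_indep:
      "indep_vars (\<lambda>_. borel) (case_sum eps (\<lambda>(t, j). eta t j))
         (Inl ` {1..} \<union> Inr ` ({1..} \<times> UNIV))"
    and first_input: "\<omega> \<in> space P \<Longrightarrow> x 1 \<omega> \<in> D"
    and observation: "t \<ge> 1 \<Longrightarrow> \<omega> \<in> space P \<Longrightarrow> y t \<omega> = f t (x t \<omega>) + eps t \<omega>"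
    and selection: "t \<ge> 1 \<Longrightarrow> \<omega> \<in> space P \<Longrightarrow> S t \<omega> \<subseteq> {..<t} \<and> card (S t \<omega>) = Q t"
    and sampling:
      "t \<ge> 1 \<Longrightarrow>
       AE \<omega> in P. real_cond_exp P (history P x eps eta S t) (indicator (S t -` {Z} \<inter> space P)) \<omega> =
         pmf (mcmc_law (kernel_mat k (points (\<lambda>i. x i \<omega>) t)) (Q t) (steps t (Q t) (acc t))) Z"
    and acquisition:
      "t \<ge> 1 \<Longrightarrow> \<omega> \<in> space P \<Longrightarrow>
       is_arg_max
         (\<lambda>z. post_mean k (run_data f \<sigma> \<sigma>e x y eta S \<omega> t) z +
              ucb_beta k \<delta> (run_data f \<sigma> \<sigma>e x y eta S \<omega> (t + h)) (rkhs_norm ip (f (t + 1))) *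
                sqrt (post_var k (run_data f \<sigma> \<sigma>e x y eta S \<omega> t) z))
         (\<lambda>z. z \<in> D) (x (t + 1) \<omega>)"

section \<open>Computational complexity\<close>

text \<open>
  \<open>cgp n\<close> is the cost of Gaussian process regression with \<open>n\<close> inputs. The expert's answers and
  the maximization of the acquisition function are not counted.
\<close>

definition complexity ::
  "(nat \<Rightarrow> nat \<Rightarrow> real) \<Rightarrow> (nat \<Rightarrow> nat \<Rightarrow> real) \<Rightarrow> (nat \<Rightarrow> nat \<Rightarrow> real \<Rightarrow> nat) \<Rightarrow> (nat \<Rightarrow> real) \<Rightarrow>
   (nat \<Rightarrow> nat) \<Rightarrow> (nat \<Rightarrow> real) \<Rightarrow> (nat \<Rightarrow> 'a data) \<Rightarrow> nat \<Rightarrow> real" where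
  "complexity cinit cstep steps cgp Q acc dat T =
     (\<Sum>t = 1..T. sampling_cost cinit cstep steps t (Q t) (acc t) +
                  cgp (length (dat t)))"

definition soft_bigo :: "(nat \<Rightarrow> real) \<Rightarrow> (nat \<Rightarrow> real) set" where
  "soft_bigo g = {u. \<exists>p::nat. u \<in> O(\<lambda>T. g T * ln (real T) ^ p)}"

end

theory Submission
  imports Defs "HOL-Real_Asymp.Real_Asymp"
begin

text \<open>
  An observation survives at time \<open>t\<close> only if its age \<open>m\<close> satisfies \<open>m\<^sup>2 + 1 \<le> log t\<close>, so at most
  \<open>log t\<close> of them survive and a regression step has \<open>O(log\<^sup>d t)\<close> inputs, whatever the trajectory.
  Since \<open>Q t \<le> t\<close> and \<open>1 / acc t\<close> is of order \<open>t\<close>, the logarithmic factor in the cost of the sampler is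
  \<open>O(log t)\<close>. Hence iteration \<open>t\<close> costs \<open>O(t log\<^sup>3\<^sup>d\<^sup>+\<^sup>1 t)\<close>; this bound is monotone, so
  summing it over \<open>t \<le> T\<close> costs one more factor \<open>T\<close>, and \<open>log T\<close> and \<open>log (T / log T)\<close> are of the
  same order.
\<close>

text \<open>The terms before the bound on \<open>a\<close> sets in contribute at most a constant
  \<open>?K\<close>; each of the at most \<open>n\<close> others is bounded by
  \<open>c * b i \<le> c * b n\<close>. The hypothesis \<open>one\<close> lets
  \<open>real n * b n\<close> absorb \<open>?K\<close>.\<close>

lemma sum_bigo_mono:
  fixes a b :: "nat \<Rightarrow> real"
  assumes a: "a \<in> O(b)" and b: "mono b" "b 0 \<ge> 0"
    and one: "(\<lambda>_. 1) \<in> O(\<lambda>n. real n * b n)"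
  shows "(\<lambda>n. \<Sum>i=1..n. a i) \<in> O(\<lambda>n. real n * b n)"
proof -
  obtain c where c: "c > 0" "\<forall>\<^sub>F i in sequentially. norm (a i) \<le> c * norm (b i)"
    using a by (rule landau_o.bigE)
  then obtain N where N: "\<bar>a i\<bar> \<le> c * \<bar>b i\<bar>" if "i \<ge> N" for i
    unfolding eventually_sequentially by auto
  have b_nonneg: "b i \<ge> 0" for i
    using monoD[OF b(1), of 0 i] b(2) by simp
  let ?K = "\<Sum>i<N. \<bar>a i\<bar>"
  have bound: "\<bar>\<Sum>i=1..n. a i\<bar> \<le> ?K + c * (real n * b n)" for n
  proof -
    have "\<bar>a i\<bar> \<le> (if i < N then \<bar>a i\<bar> else 0) + c * b n" if "i \<in> {1..n}" for i
    proof (cases "i < N")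
      case True
      then show ?thesis using c(1) b_nonneg by simp
    next
      case False
      then have "\<bar>a i\<bar> \<le> c * b i" using N[of i] b_nonneg[of i] by simp
      also have "\<dots> \<le> c * b n"
        using that c(1) monoD[OF b(1), of i n] by simp
      finally show ?thesis using False by simp
    qed
    then have "(\<Sum>i=1..n. \<bar>a i\<bar>) \<le> (\<Sum>i=1..n. (if i < N then \<bar>a i\<bar> else 0) + c * b n)"
      by (rule sum_mono)
    also have "\<dots> = (\<Sum>i\<in>{1..n} \<inter> {..<N}. \<bar>a i\<bar>) + c * (real n * b n)"
      by (simp add: sum.distrib sum.inter_restrict lessThan_def)
    also have "(\<Sum>i\<in>{1..n} \<inter> {..<N}. \<bar>a i\<bar>) \<le> ?K"
      by (rule sum_mono2) auto
    finally show ?thesis using sum_abs[of a "{1..n}"] by linarith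
  qed
  have "(\<lambda>n. \<Sum>i=1..n. a i) \<in> O(\<lambda>n. ?K + c * (real n * b n))"
  proof (rule landau_o.big_mono, intro always_eventually allI)
    fix n
    show "norm (\<Sum>i=1..n. a i) \<le> norm (?K + c * (real n * b n))"
      using bound[of n] by simp
  qed
  also have "(\<lambda>n. ?K + c * (real n * b n)) \<in> O(\<lambda>n. real n * b n)"
  proof (rule sum_in_bigo)
    show "(\<lambda>n. ?K) \<in> O(\<lambda>n. real n * b n)"
      using landau_o.big.mult[OF bigo_const[of ?K] one] by simp
  qed simp
  finally show ?thesis .
qed

text \<open>Makes the bound valid at every \<open>n\<close>, since the size of a data set varies
  with the trajectory and may stay small. The majorant is monotone even if \<open>c\<close> is not,
  so upper bounds on the size can be inserted. The summand 1 takes up the finitely many exceptional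
  values.\<close>

lemma bigo_majorant:
  fixes c :: "nat \<Rightarrow> real"
  assumes "c \<in> O(\<lambda>n. real n ^ p)"
  obtains G where "G \<ge> 0" "\<And>n. c n \<le> G * (1 + real n ^ p)"
proof -
  obtain C where C: "C > 0" "\<forall>\<^sub>F n in sequentially. norm (c n) \<le> C * norm (real n ^ p)"
    using assms by (rule landau_o.bigE)
  then obtain N where N: "\<bar>c n\<bar> \<le> C * real n ^ p" if "n \<ge> N" for n
    unfolding eventually_sequentially by auto
  let ?K = "\<Sum>i<N. \<bar>c i\<bar>"
  have K: "?K \<ge> 0" by (simp add: sum_nonneg)
  have "c n \<le> (C + ?K) * (1 + real n ^ p)" for n
  proof -
    have "c n \<le> ?K + C * real n ^ p"
    proof (cases "n < N")
      case True
      then have "\<bar>c n\<bar> \<le> ?K" by (intro member_le_sum) auto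
      then show ?thesis using C(1) by (smt (verit) mult_nonneg_nonneg of_nat_0_le_iff zero_le_power)
    next
      case False
      then show ?thesis using N[of n] K by linarith
    qed
    also have "\<dots> \<le> (C + ?K) * (1 + real n ^ p)"
      using C(1) K by (simp add: algebra_simps)
    finally show ?thesis .
  qed
  then show ?thesis using C(1) K that[of "C + ?K"] by simp
qed

lemma length_kept_data:
  assumes "t \<ge> 1" "\<sigma> > 0"
  shows "real (length (kept_data \<sigma> xs ys t)) \<le> ln (real t)"
proof -
  let ?A = "{i \<in> {1..t}. \<not> injected_var \<sigma> t i > \<sigma>\<^sup>2 * ln (real t)}"
  \<comment> \<open>A natural number is at most its square, so the quadratic condition on the age
    becomes linear. Its \<open>+ 1\<close> puts every age strictly below the floor of
    \<open>ln (real t)\<close>, and the count needs no additive constant.\<close>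
  have age: "real (t - i) + 1 \<le> ln (real t)" "i \<le> t" if "i \<in> ?A" for i
  proof -
    have "(real (t - i))\<^sup>2 + 1 \<le> ln (real t)"
      using that assms(2) by (auto simp: injected_var_def of_nat_diff)
    moreover have "real (t - i) \<le> (real (t - i))\<^sup>2"
      by (metis of_nat_le_iff of_nat_power power2_nat_le_imp_le self_le_ge2_pow le_square power2_eq_square)
    ultimately show "real (t - i) + 1 \<le> ln (real t)" by linarith
  qed (use that in auto)
  have "length (kept_data \<sigma> xs ys t) = card ?A"
    unfolding kept_data_def length_map
    by (subst distinct_card[symmetric]) (auto intro!: arg_cong[of _ _ card])
  \<comment> \<open>Positions are counted by age; truncated subtraction is injective here because
    \<open>i \<le> t\<close>.\<close>
  also have "\<dots> = card ((\<lambda>i. t - i) ` ?A)"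
    by (intro card_image[symmetric] inj_onI) (metis (no_types, lifting) age(2) diff_diff_cancel)
  also have "\<dots> \<le> card {..<nat \<lfloor>ln (real t)\<rfloor>}"
  proof (intro card_mono image_subsetI)
    fix i assume "i \<in> ?A"
    from age(1)[OF this] show "t - i \<in> {..<nat \<lfloor>ln (real t)\<rfloor>}"
      by simp linarith
  qed auto
  also have "real \<dots> \<le> ln (real t)"
    using assms(1) by (simp add: ln_ge_zero_iff)
  finally show ?thesis by simp
qed

text \<open>\<open>selection\<close> holds at every \<open>\<omega>\<close> of the space and counts
  positions, not distinct inputs. The expert thus contributes exactly \<open>Q t\<close> entries on
  each trajectory.\<close>

lemma (in sparq_gp_ucb) length_run_data:
  assumes "t \<ge> 1" "\<sigma> > 0" "\<omega> \<in> space P"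
  shows "real (length (run_data f \<sigma> \<sigma>e x y eta S \<omega> t)) \<le> real (Q t) + ln (real t)"
proof -
  have "length (sorted_list_of_set (S t \<omega>)) = Q t"
    using selection[OF assms(1,3)] by simp
  then show ?thesis
    using length_kept_data[OF assms(1,2)]
    by (simp add: run_data_def sparse_data_def expert_data_def)
qed

text \<open>The cube of \<open>Q t\<close> gives \<open>3 * d\<close> logarithms, the bracket of the
  guarantee one more. Of \<open>accuracy\<close>, the upper half brings \<open>acc t\<close> into
  the range where the guarantee applies, the lower half controls
  \<open>ln (1 / (acc t)\<^sup>2)\<close>.\<close>

lemma sampling_cost_bigo:
  assumes cost_nonneg: "\<And>N M. cinit N M \<ge> 0" "\<And>N M. cstep N M \<ge> 0"
    and sampler: "sampler_guarantee cinit cstep steps"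
    and budget_le: "\<And>t. t \<ge> 1 \<Longrightarrow> Q t \<le> t"
    and budget: "(\<lambda>t. real (Q t)) \<in> O(\<lambda>t. ln (real t) ^ d)"
    and accuracy_pos: "\<And>t. t \<ge> 1 \<Longrightarrow> acc t > 0"
    and accuracy: "acc \<in> \<Theta>(\<lambda>t. 1 / real t)"
  shows "(\<lambda>t. sampling_cost cinit cstep steps t (Q t) (acc t))
           \<in> O(\<lambda>t. real t * ln (real t) ^ (3 * d + 1))"
proof -
  obtain c where c: "c > 0" "\<forall>\<^sub>F t in sequentially. c * norm (1 / real t) \<le> norm (acc t)"
    using accuracy by (auto simp: bigtheta_def elim: landau_omega.bigE)
  have acc_le: "\<forall>\<^sub>F t in sequentially. acc t \<le> 1"
  proof -
    have "acc \<in> O(\<lambda>t. 1 / real t)" using accuracy by blast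
    also have "(\<lambda>t::nat. 1 / real t) \<in> o(\<lambda>_. 1 :: real)" by real_asymp
    finally have "\<forall>\<^sub>F t in sequentially. norm (acc t) \<le> 1 * norm (1::real)"
      by (rule landau_o.smallD) simp
    then show ?thesis by eventually_elim simp
  qed
  let ?L = "\<lambda>t. ln (ln (real t)) + ln (real (Q t)) + ln (1 / (acc t)\<^sup>2)"
  obtain C where C: "sampling_cost cinit cstep steps N M \<epsilon> \<le>
      C * (real N * real M ^ 3 * (ln (ln (real N)) + ln (real M) + ln (1 / \<epsilon>\<^sup>2)))"
    if "N \<ge> 3" "M \<in> {1..N}" "\<epsilon> \<in> {0<..1}" for N M \<epsilon>
    using sampler unfolding sampler_guarantee_def by blast
  have "(\<lambda>t. sampling_cost cinit cstep steps t (Q t) (acc t))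
      \<in> O(\<lambda>t. real t * real (Q t) ^ 3 * ?L t)"
  \<comment> \<open>The guarantee does not fix the sign of \<open>C\<close>, hence the absolute
    value.\<close>
  proof (rule bigoI)
    show "\<forall>\<^sub>F t in sequentially. norm (sampling_cost cinit cstep steps t (Q t) (acc t))
        \<le> \<bar>C\<bar> * norm (real t * real (Q t) ^ 3 * ?L t)"
      using acc_le eventually_ge_at_top[of 3]
    proof eventually_elim
      case (elim t)
      show ?case
      \<comment> \<open>The guarantee starts at one selected point; an empty selection is free by
        definition.\<close>
      proof (cases "Q t = 0")
        case True
        then show ?thesis by (simp add: sampling_cost_def)
      next
        case False
        have "sampling_cost cinit cstep steps t (Q t) (acc t)
            \<le> C * (real t * real (Q t) ^ 3 * ?L t)"
          using False elim budget_le[of t] accuracy_pos[of t] by (intro C) auto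
        also have "\<dots> \<le> \<bar>C\<bar> * norm (real t * real (Q t) ^ 3 * ?L t)"
          by (metis abs_ge_self abs_mult real_norm_def)
        finally show ?thesis
          using cost_nonneg by (simp add: sampling_cost_def)
      qed
    qed
  qed
  also have "(\<lambda>t. real t * real (Q t) ^ 3 * ?L t)
      \<in> O(\<lambda>t. real t * (ln (real t) ^ d) ^ 3 * ln (real t))"
  proof (intro landau_o.big.mult landau_o.big_power landau_o.big_refl budget sum_in_bigo)
    show "(\<lambda>t. ln (ln (real t))) \<in> O(\<lambda>t. ln (real t))" by real_asymp
    show "(\<lambda>t. ln (real (Q t))) \<in> O(\<lambda>t. ln (real t))"
    proof (rule landau_o.big_mono)
      show "\<forall>\<^sub>F t in sequentially. norm (ln (real (Q t))) \<le> norm (ln (real t))"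
        using eventually_ge_at_top[of 1]
      proof eventually_elim
        case (elim t)
        \<comment> \<open>The case \<open>Q t = 0\<close> rests on the convention
          \<open>ln 0 = 0\<close>.\<close>
        then show ?case using budget_le[of t] by (cases "Q t = 0") auto
      qed
    qed
    show "(\<lambda>t. ln (1 / (acc t)\<^sup>2)) \<in> O(\<lambda>t. ln (real t))"
    proof -
      \<comment> \<open>From \<open>c / real t \<le> acc t\<close>. Since
        \<open>acc t \<le> 1\<close> eventually, the left logarithm is nonnegative, so the one-sided
        estimate also bounds its norm.\<close>
      have "(\<lambda>t. ln (1 / (acc t)\<^sup>2)) \<in> O(\<lambda>t. 2 * ln (real t / c))"
      proof (rule landau_o.big_mono)
        show "\<forall>\<^sub>F t in sequentially. norm (ln (1 / (acc t)\<^sup>2)) \<le> norm (2 * ln (real t / c))"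
          using acc_le c(2) eventually_ge_at_top[of 1]
        proof eventually_elim
          case (elim t)
          then have acc: "0 < acc t" "acc t \<le> 1" "c / real t \<le> acc t"
            using accuracy_pos[of t] by auto
          then have "1 / acc t \<le> real t / c"
            using c(1) elim by (simp add: field_simps)
          then have "ln (1 / acc t) \<le> ln (real t / c)"
            using acc by (subst ln_le_cancel_iff) (auto intro: less_le_trans[of _ "1 / acc t"])
          moreover have "ln (1 / (acc t)\<^sup>2) = 2 * ln (1 / acc t)"
            using acc by (simp add: ln_div ln_realpow)
          moreover have "ln (1 / acc t) \<ge> 0" using acc by simp
          ultimately show ?case by simp
        qed
      qed
      also have "(\<lambda>t. 2 * ln (real t / c)) \<in> O(\<lambda>t. ln (real t))"
        using c(1) by real_asymp
      finally show ?thesis .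
    qed
  qed
  also have "(\<lambda>t. real t * (ln (real t) ^ d) ^ 3 * ln (real t))
      = (\<lambda>t. real t * ln (real t) ^ (3 * d + 1))"
    by (simp add: fun_eq_iff power_mult[symmetric] mult_ac)
  finally show ?thesis .
qed

theorem theorem2:
  fixes P :: "'w measure"
    and D :: "(real ^ 'd) set" and k :: "real ^ 'd \<Rightarrow> real ^ 'd \<Rightarrow> real"
    and H :: "(real ^ 'd \<Rightarrow> real) set"
    and ip :: "(real ^ 'd \<Rightarrow> real) \<Rightarrow> (real ^ 'd \<Rightarrow> real) \<Rightarrow> real"
    and f :: "nat \<Rightarrow> real ^ 'd \<Rightarrow> real"
    and \<delta> \<sigma> \<sigma>e M\<^sub>k B :: real
    and Q :: "nat \<Rightarrow> nat" and acc :: "nat \<Rightarrow> real" and h :: nat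
    and x :: "nat \<Rightarrow> 'w \<Rightarrow> real ^ 'd" and y eps :: "nat \<Rightarrow> 'w \<Rightarrow> real"
    and eta :: "nat \<Rightarrow> nat \<Rightarrow> 'w \<Rightarrow> real" and S :: "nat \<Rightarrow> 'w \<Rightarrow> nat set"
    and cinit cstep :: "nat \<Rightarrow> nat \<Rightarrow> real" and cgp :: "nat \<Rightarrow> real"
    and steps :: "nat \<Rightarrow> nat \<Rightarrow> real \<Rightarrow> nat"
  assumes delta: "0 < \<delta>" "\<delta> \<le> 1"
    and noise_levels: "\<sigma> > 0" "\<sigma>e > 0"
    and domain: "compact D" "convex D"
    and kernel: "squared_exponential_kernel k"
    and kernel_cont: "continuous_on (D \<times> D) (\<lambda>(u, v). k u v)"
    and kernel_bound: "\<And>z. z \<in> D \<Longrightarrow> k z z \<le> M\<^sub>k\<^sup>2"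
    and rkhs: "rkhs D k H ip"
    and reward_rkhs: "\<And>t. t \<ge> 1 \<Longrightarrow> f t \<in> H"
    and reward_norm: "\<And>t. t \<ge> 1 \<Longrightarrow> rkhs_norm ip (f t) \<le> B"
    and reward_drift: "\<And>t z. t \<ge> 1 \<Longrightarrow> z \<in> D \<Longrightarrow> \<bar>f (t + 1) z - f t z\<bar> \<le> 1"
    and budget_le: "\<And>t. t \<ge> 1 \<Longrightarrow> Q t \<le> t"
    and budget: "(\<lambda>t. real (Q t)) \<in> O(\<lambda>t. ln (real t) ^ CARD('d))"
    and accuracy_pos: "\<And>t. t \<ge> 1 \<Longrightarrow> acc t > 0"
    and accuracy: "acc \<in> \<Theta>(\<lambda>t. 1 / real t)"
    and lag: "h \<in> {0, 1}"
    and run: "sparq_gp_ucb P D k ip f \<delta> \<sigma> \<sigma>e Q acc steps h x y eps eta S"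
    and cost_nonneg: "\<And>N M. cinit N M \<ge> 0" "\<And>N M. cstep N M \<ge> 0" "\<And>n. cgp n \<ge> 0"
    and sampler: "sampler_guarantee cinit cstep steps"
    and gp_regression: "cgp \<in> O(\<lambda>n. real n ^ 3)"
  shows "(\<exists>g \<in> O(\<lambda>T. real T ^ 2 * ln (real T) * ln (real T / ln (real T)) ^ (3 * CARD('d))).
            \<forall>\<omega>\<in>space P. \<forall>T.
              complexity cinit cstep steps cgp Q acc (run_data f \<sigma> \<sigma>e x y eta S \<omega>) T \<le> g T) \<and>
         O(\<lambda>T. real T ^ 2 * ln (real T) * ln (real T / ln (real T)) ^ (3 * CARD('d)))
           \<subseteq> soft_bigo (\<lambda>T. real T ^ 2)"
proof -
  let ?d = "CARD('d)"
  let ?b = "\<lambda>t. real t * ln (real t) ^ (3 * ?d + 1)"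
  let ?goal = "\<lambda>T. real T ^ 2 * ln (real T) * ln (real T / ln (real T)) ^ (3 * ?d)"
  let ?s = "\<lambda>t. sampling_cost cinit cstep steps t (Q t) (acc t)"
  obtain G where G: "G \<ge> 0" "\<And>n. cgp n \<le> G * (1 + real n ^ 3)"
    using bigo_majorant[OF gp_regression] by blast
  \<comment> \<open>The random number of regression inputs is replaced by its pathwise bound, so
    that the witness \<open>g\<close> is deterministic and serves all trajectories at once.\<close>
  let ?r = "\<lambda>t. G * (1 + (real (Q t) + ln (real t)) ^ 3)"
  define g where "g T = (\<Sum>t = 1..T. ?s t + ?r t)" for T
  have "complexity cinit cstep steps cgp Q acc (run_data f \<sigma> \<sigma>e x y eta S \<omega>) T \<le> g T"
    if "\<omega> \<in> space P" for \<omega> T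
  proof -
    let ?n = "\<lambda>t. length (run_data f \<sigma> \<sigma>e x y eta S \<omega> t)"
    have "cgp (?n t) \<le> ?r t" if "t \<in> {1..T}" for t
    proof -
      have "real (?n t) ^ 3 \<le> (real (Q t) + ln (real t)) ^ 3"
        using that sparq_gp_ucb.length_run_data[OF run _ noise_levels(1) \<open>\<omega> \<in> space P\<close>]
        by (intro power_mono) auto
      then show ?thesis using G(2)[of "?n t"] G(1)
        by (smt (verit) mult_left_mono)
    qed
    then show ?thesis unfolding complexity_def g_def by (intro sum_mono add_left_mono)
  qed
  moreover have "g \<in> O(?goal)"
  proof -
    \<comment> \<open>As \<open>CARD('d)\<close> is at least 1, the kept observations do not exceed
      the order of the expert budget.\<close>
    have "(\<lambda>t. ln (real t)) \<in> O(\<lambda>t. ln (real t) ^ ?d)"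
    proof (rule landau_o.big_mono)
      have "\<forall>\<^sub>F t in sequentially. ln (real t) \<ge> 1" by real_asymp
      then show "\<forall>\<^sub>F t in sequentially. norm (ln (real t)) \<le> norm (ln (real t) ^ ?d)"
        by eventually_elim (simp add: self_le_power power_abs)
    qed
    from sum_in_bigo(1)[OF budget this]
    have "(\<lambda>t. (real (Q t) + ln (real t)) ^ 3) \<in> O(\<lambda>t. (ln (real t) ^ ?d) ^ 3)"
      by (rule landau_o.big_power)
    \<comment> \<open>Regression is cheaper than the bound for sampling, so the single rate
      \<open>?b\<close> covers both.\<close>
    also have "(\<lambda>t. (ln (real t) ^ ?d) ^ 3) \<in> O(?b)"
    proof (rule landau_o.big_mono)
      have "\<forall>\<^sub>F t in sequentially. ln (real t) \<ge> 1 \<and> real t \<ge> 1"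
        by (intro eventually_conj) real_asymp+
      then show "\<forall>\<^sub>F t in sequentially. norm ((ln (real t) ^ ?d) ^ 3) \<le> norm (?b t)"
      proof eventually_elim
        case (elim t)
        then have "1 * ln (real t) ^ (3 * ?d) \<le> real t * ln (real t) ^ (3 * ?d + 1)"
          by (intro mult_mono power_increasing) auto
        then show ?case using elim by (simp add: power_mult[symmetric] mult.commute)
      qed
    qed
    finally have cube: "(\<lambda>t. (real (Q t) + ln (real t)) ^ 3) \<in> O(?b)" .
    have one: "(\<lambda>_. 1) \<in> O(?b)"
      by real_asymp
    have "(\<lambda>t. ?s t + ?r t) \<in> O(?b)"
    proof (rule sum_in_bigo)
      show "?s \<in> O(?b)"
        by (rule sampling_cost_bigo) (fact cost_nonneg sampler budget_le budget accuracy_pos accuracy)+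
      show "?r \<in> O(?b)"
        using sum_in_bigo(1)[OF one cube] by (cases "G = 0") simp_all
    qed
    then have "g \<in> O(\<lambda>T. real T * ?b T)"
      unfolding g_def
    proof (rule sum_bigo_mono)
      \<comment> \<open>Because \<open>ln 0 = 0\<close>, the logarithm is nonnegative and monotone
        on all naturals, and monotonicity holds from 0 on.\<close>
      show "mono ?b"
      proof (rule monoI)
        fix m n :: nat assume "m \<le> n"
        moreover have "ln (real i) \<ge> 0" for i :: nat by (cases "i = 0") auto
        moreover from \<open>m \<le> n\<close> have "ln (real m) \<le> ln (real n)"
          by (cases "m = 0") (use calculation in auto)
        ultimately show "?b m \<le> ?b n"
          by (intro mult_mono power_mono) auto
      qed
      show "(\<lambda>_. 1) \<in> O(\<lambda>T. real T * ?b T)" by real_asymp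
    qed simp
    also have "(\<lambda>T. real T * ?b T) = (\<lambda>T. real T ^ 2 * ln (real T) * ln (real T) ^ (3 * ?d))"
      by (simp add: fun_eq_iff power2_eq_square mult_ac)
    \<comment> \<open>\<open>ln (T / ln T) = ln T - ln (ln T)\<close> is asymptotic to
      \<open>ln T\<close>.\<close>
    also have "\<dots> \<in> O(?goal)"
      by (intro landau_o.big.mult landau_o.big_power landau_o.big_refl) real_asymp
    finally show ?thesis .
  qed
  moreover have "O(?goal) \<subseteq> soft_bigo (\<lambda>T. real T ^ 2)"
  proof
    fix u assume "u \<in> O(?goal)"
    also have "?goal \<in> O(\<lambda>T. real T ^ 2 * ln (real T) * ln (real T) ^ (3 * ?d))"
      by (intro landau_o.big.mult landau_o.big_power landau_o.big_refl) real_asymp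
    also have "(\<lambda>T. real T ^ 2 * ln (real T) * ln (real T) ^ (3 * ?d))
        = (\<lambda>T. real T ^ 2 * ln (real T) ^ (3 * ?d + 1))"
      by (simp add: mult_ac)
    \<comment> \<open>The polylogarithmic exponent is \<open>p = 3 * ?d + 1\<close>.\<close>
    finally show "u \<in> soft_bigo (\<lambda>T. real T ^ 2)" unfolding soft_bigo_def by blast
  qed
  ultimately show ?thesis by blast
qed

end
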